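(* Let $G$ be a graph on $n$ vertices with maximum degree $\Delta>0$. If $k\le \frac{n}{51\,\Delta^2}$, then every $k$-bounded edge colouring $\chi$ of the complete graph $K_n$ is $G$-rainbow, that is, $K_n$ contains a copy of $G$ which is rainbow coloured by $\chi$.
   Context: Graphs are finite and simple. An edge colouring is an arbitrary assignment of colours to edges (not necessarily proper). An edge colouring $\chi$ of a graph $F$ is $k$-bounded if no colour is used by $\chi$ on more than $k$ edges of $F$. For an $n$-vertex graph $G$, a copy of $G$ in $K_n$ is the image of $G$ under an injection $\sigma\colon V(G)\to V(K_n)$, with edges $\sigma(x)\sigma(y)$ for $xy\in E(G)$. A copy is rainbow coloured by $\chi$ if all edges of the copy receive pairwise different colours from $\chi$. A colouring $\chi$ of the edges of $K_n$ is $G$-rainbow if $K_n$ contains a copy of $G$ which is rainbow coloured by $\chi$. *)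

theory Defs
  imports Complex_Main "HOL-Library.Ramsey"
begin

text \<open>A graph is given by its vertex set and its edge set; edges are 2-element vertex sets
  (\<^term>\<open>nsets V 2\<close> is the set of all 2-element subsets of \<open>V\<close>), so there are no loops
  and no multiple edges.\<close>

definition simple_graph :: "'a set \<Rightarrow> 'a set set \<Rightarrow> bool" where
  "simple_graph V E \<longleftrightarrow> finite V \<and> E \<subseteq> nsets V 2"

definition degree :: "'a set set \<Rightarrow> 'a \<Rightarrow> nat" where
  "degree E v = card {e \<in> E. v \<in> e}"

text \<open>The inserted \<open>0\<close> only matters for the graph without vertices, where \<open>Max\<close> of the empty set
  would be unspecified.\<close>

definition max_degree :: "'a set \<Rightarrow> 'a set set \<Rightarrow> nat" where
  "max_degree V E = Max (insert 0 (degree E ` V))"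

definition complete_verts :: "nat \<Rightarrow> nat set" where
  "complete_verts n = {..<n}"

definition complete_edges :: "nat \<Rightarrow> nat set set" where
  "complete_edges n = nsets (complete_verts n) 2"

text \<open>An edge colouring is a function on vertex sets of which only the values on edges matter;
  it need not be proper. The edge set \<open>F\<close> below is meant to be finite (for infinite colour classes
  \<open>card\<close> would be 0).\<close>

definition bounded_colouring :: "nat \<Rightarrow> 'b set set \<Rightarrow> ('b set \<Rightarrow> 'c) \<Rightarrow> bool" where
  "bounded_colouring k F \<chi> \<longleftrightarrow> (\<forall>c. card {e \<in> F. \<chi> e = c} \<le> k)"

definition is_copy_in_complete :: "'a set \<Rightarrow> 'a set set \<Rightarrow> nat \<Rightarrow> nat set \<Rightarrow> nat set set \<Rightarrow> bool" where
  "is_copy_in_complete V E n W F \<longleftrightarrow>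
     (\<exists>\<sigma>. inj_on \<sigma> V \<and> \<sigma> ` V \<subseteq> complete_verts n \<and> W = \<sigma> ` V \<and> F = {\<sigma> ` e | e. e \<in> E})"

definition rainbow_edges :: "('b set \<Rightarrow> 'c) \<Rightarrow> 'b set set \<Rightarrow> bool" where
  "rainbow_edges \<chi> F \<longleftrightarrow> (\<forall>e\<in>F. \<forall>f\<in>F. e \<noteq> f \<longrightarrow> \<chi> e \<noteq> \<chi> f)"

definition graph_rainbow :: "'a set \<Rightarrow> 'a set set \<Rightarrow> nat \<Rightarrow> (nat set \<Rightarrow> 'c) \<Rightarrow> bool" where
  "graph_rainbow V E n \<chi> \<longleftrightarrow>
     (\<exists>W F. is_copy_in_complete V E n W F \<and> rainbow_edges \<chi> F)"

end

theory Submission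
  imports Defs "HOL-Library.FuncSet"
begin

text \<open>
  Choose a bijection \<open>\<sigma>\<close> from \<open>V\<close> to \<open>{..<n}\<close> uniformly at random. The bad events are that \<open>\<sigma>\<close>
  agrees with a given partial injection (a \<^emph>\<open>pattern\<close>) that maps two edges of the graph to edges of
  the same colour. By the lopsided local lemma it suffices that the probabilities of the bad
  patterns sharing a point of the domain or of the image with a given pattern add up to at most
  \<open>1/4\<close>. A pattern has at most four points on each side, and double counting shows that the patterns
  through a fixed point have total probability at most
  \<open>k \<Delta>\<^sup>2 n / ((n - 2) (n - 3)) \<le> 1/32\<close>.
\<close>

section \<open>The lopsided local lemma in counting form\<close>

text \<open>Induction on \<open>T\<close> shows that, among the outcomes avoiding \<open>T\<close>,
  a proportion of at most \<open>2 * p i\<close> satisfies \<open>A i\<close>. To this end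
  \<open>T\<close> is split into the neighbours \<open>T1\<close> of \<open>i\<close> and the rest
  \<open>T2\<close>, to which \<open>lop\<close> applies. Avoiding the indices one after another
  then always leaves some outcome. Cardinalities replace conditional probabilities, so no division
  by a possibly empty set occurs.\<close>

lemma lopsided_local_lemma:
  fixes \<Omega> :: "'b set" and I :: "'i set" and A :: "'i \<Rightarrow> 'b \<Rightarrow> bool" and p :: "'i \<Rightarrow> real"
  assumes fin: "finite \<Omega>" "finite I" and ne: "\<Omega> \<noteq> {}"
    and p0: "\<And>i. i \<in> I \<Longrightarrow> 0 \<le> p i"
    and p1: "\<And>i. i \<in> I \<Longrightarrow> p i \<le> 1/4"
    and small: "\<And>i. i \<in> I \<Longrightarrow> (\<Sum>j | j \<in> I \<and> nb i j. p j) \<le> 1/4"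
    and lop: "\<And>i T. i \<in> I \<Longrightarrow> T \<subseteq> I \<Longrightarrow> (\<And>j. j \<in> T \<Longrightarrow> \<not> nb i j) \<Longrightarrow>
      real (card {\<omega> \<in> \<Omega>. A i \<omega> \<and> (\<forall>j\<in>T. \<not> A j \<omega>)}) \<le> p i * real (card {\<omega> \<in> \<Omega>. \<forall>j\<in>T. \<not> A j \<omega>})"
  shows "\<exists>\<omega>\<in>\<Omega>. \<forall>i\<in>I. \<not> A i \<omega>"
proof -
  define N where "N T = {\<omega> \<in> \<Omega>. \<forall>j\<in>T. \<not> A j \<omega>}" for T
  define B where "B i T = {\<omega> \<in> \<Omega>. A i \<omega> \<and> (\<forall>j\<in>T. \<not> A j \<omega>)}" for i T
  have finN: "finite (N T)" "finite (B i T)" for T i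
    using fin by (auto simp: N_def B_def)
  have cond: "real (card (B i T)) \<le> 2 * p i * real (card (N T))"
    if "finite T" "T \<subseteq> I" "i \<in> I" for T i
    using that
  proof (induction T arbitrary: i rule: finite_psubset_induct)
    case (psubset T)
    define T1 T2 where "T1 = {j \<in> T. nb i j}" and "T2 = {j \<in> T. \<not> nb i j}"
    have T: "T = T1 \<union> T2" "T1 \<subseteq> I" "T2 \<subseteq> I" "finite T1" "finite T2"
      using psubset by (auto simp: T1_def T2_def)
    have lop2: "real (card (B i T2)) \<le> p i * real (card (N T2))"
      unfolding N_def B_def
      by (rule lop[OF psubset.prems(2) T(3)]) (simp add: T2_def)
    have "B i T \<subseteq> B i T2" using T by (auto simp: B_def)
    then have le: "card (B i T) \<le> card (B i T2)" by (simp add: card_mono finN)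
    \<comment> \<open>Passing from \<open>T2\<close> to \<open>T\<close> loses at most half of the
      outcomes: by induction each neighbour \<open>j\<close> removes at most a proportion
      \<open>2 * p j\<close>, and these add up to at most 1/2. The induction hypothesis needs
      \<open>T2\<close> to be a proper subset, hence the case distinction.\<close>
    have half: "real (card (N T2)) \<le> 2 * real (card (N T))"
    proof (cases "T1 = {}")
      case True
      then show ?thesis using T by simp
    next
      case False
      then have "T2 \<subset> T" by (auto simp: T1_def T2_def)
      then have IH: "real (card (B j T2)) \<le> 2 * p j * real (card (N T2))" if "j \<in> T1" for j
        using psubset.IH[of T2 j] that T by auto
      have "N T2 \<subseteq> N T \<union> (\<Union>j\<in>T1. B j T2)"
        using T by (auto simp: N_def B_def)
      then have "card (N T2) \<le> card (N T \<union> (\<Union>j\<in>T1. B j T2))"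
        by (intro card_mono) (simp_all add: finN T(4))
      also have "\<dots> \<le> card (N T) + (\<Sum>j\<in>T1. card (B j T2))"
        using card_Un_le[of "N T" "\<Union>j\<in>T1. B j T2"] card_UN_le[OF T(4), of "\<lambda>j. B j T2"] by linarith
      finally have "real (card (N T2)) \<le> real (card (N T)) + (\<Sum>j\<in>T1. real (card (B j T2)))"
        by (metis of_nat_add of_nat_le_iff of_nat_sum)
      also have "(\<Sum>j\<in>T1. real (card (B j T2))) \<le> (\<Sum>j\<in>T1. 2 * p j * real (card (N T2)))"
        by (intro sum_mono IH)
      also have "\<dots> = 2 * real (card (N T2)) * (\<Sum>j\<in>T1. p j)"
        unfolding sum_distrib_left by (intro sum.cong) auto
      also have "(\<Sum>j\<in>T1. p j) \<le> (\<Sum>j | j \<in> I \<and> nb i j. p j)"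
        using fin p0 T by (intro sum_mono2) (auto simp: T1_def)
      also have "\<dots> \<le> 1/4" using small psubset.prems by blast
      finally show ?thesis by (simp add: mult_left_mono)
    qed
    have "real (card (B i T)) \<le> p i * real (card (N T2))" using le lop2 by linarith
    also have "\<dots> \<le> p i * (2 * real (card (N T)))"
      using half p0 psubset.prems by (intro mult_left_mono) auto
    finally show ?case by simp
  qed
  have "N T \<noteq> {}" if "finite T" "T \<subseteq> I" for T
    using that
  proof (induction T)
    case empty
    then show ?case using ne by (simp add: N_def)
  next
    case (insert i T)
    then have pos: "card (N T) > 0" using finN by (auto simp: card_gt_0_iff)
    show ?case
    proof
      assume "N (insert i T) = {}"
      then have "N T \<subseteq> B i T" by (auto simp: N_def B_def)
      then have "card (N T) \<le> card (B i T)" by (simp add: card_mono finN)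
      also have "real (card (B i T)) \<le> 2 * p i * real (card (N T))"
        using cond insert by auto
      \<comment> \<open>At most half of the nonempty set \<open>N T\<close> satisfies
        \<open>A i\<close>, so it cannot be all of it.\<close>
      also have "\<dots> \<le> 2 * (1/4) * real (card (N T))"
        using p1 insert.prems by (intro mult_right_mono mult_left_mono) auto
      finally show False using pos by simp
    qed
  qed
  from this[of I] show ?thesis using fin by (auto simp: N_def)
qed

section \<open>Uniform random bijections and the lopsided condition\<close>

text \<open>Extensionality makes the set finite and lets each bijection occur exactly once, so
  cardinalities measure the uniform distribution.\<close>

definition bijections :: "'a set \<Rightarrow> nat \<Rightarrow> ('a \<Rightarrow> nat) set" where
  "bijections V n = {\<sigma> \<in> V \<rightarrow>\<^sub>E {..<n}. bij_betw \<sigma> V {..<n}}"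

definition realises :: "('a \<Rightarrow> 'b) \<Rightarrow> ('a \<times> 'b) set \<Rightarrow> bool" where
  "realises \<sigma> Q \<longleftrightarrow> (\<forall>(x, y)\<in>Q. \<sigma> x = y)"

text \<open>As a graph on \<open>X\<close>, a pattern is the same object for all maps that agree on
  \<open>X\<close>.\<close>

definition pattern :: "('a \<Rightarrow> 'b) \<Rightarrow> 'a set \<Rightarrow> ('a \<times> 'b) set" where
  "pattern \<sigma> X = (\<lambda>x. (x, \<sigma> x)) ` X"

lemma realises_pattern: "realises \<sigma> (pattern \<rho> X) \<longleftrightarrow> (\<forall>x\<in>X. \<sigma> x = \<rho> x)"
  by (auto simp: realises_def pattern_def)

lemma fst_pattern [simp]: "fst ` pattern \<sigma> X = X"
  by (auto simp: pattern_def image_image)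

lemma snd_pattern [simp]: "snd ` pattern \<sigma> X = \<sigma> ` X"
  by (auto simp: pattern_def image_image)

lemma card_pattern [simp]: "card (pattern \<sigma> X) = card X"
  unfolding pattern_def by (rule card_image) (auto simp: inj_on_def)

lemma finite_bijections: "finite V \<Longrightarrow> finite (bijections V n)"
  unfolding bijections_def by (rule finite_subset[of _ "V \<rightarrow>\<^sub>E {..<n}"]) (auto intro: finite_PiE)

lemma bijections_nonempty:
  assumes "finite V" "card V = n"
  shows "bijections V n \<noteq> {}"
proof -
  obtain h where h: "bij_betw h V {..<n}"
    using finite_same_card_bij[of V "{..<n}"] assms by auto
  then have "bij_betw (restrict h V) V {..<n}" by (simp cong: bij_betw_cong)
  then have "restrict h V \<in> bijections V n"
    using h by (auto simp: bijections_def bij_betw_def)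
  then show ?thesis by blast
qed

text \<open>The two images may overlap, so simply swapping \<open>y x\<close> with
  \<open>z x\<close> would not do. Instead, \<open>y x\<close> is sent to \<open>z x\<close>; the
  complements of the two images in their union have equal size, and any bijection \<open>g\<close>
  between them completes a permutation of the union. Elsewhere it is the identity.\<close>

lemma bij_moving_injection:
  assumes X: "finite X" and y: "inj_on y X" and z: "inj_on z X"
  obtains \<tau> where "bij_betw \<tau> (y ` X \<union> z ` X) (y ` X \<union> z ` X)"
    "\<And>x. x \<in> X \<Longrightarrow> \<tau> (y x) = z x" "\<And>w. w \<notin> y ` X \<union> z ` X \<Longrightarrow> \<tau> w = w"
proof -
  define U where "U = y ` X \<union> z ` X"
  have U: "finite U" "y ` X \<subseteq> U" "z ` X \<subseteq> U" using X by (auto simp: U_def)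
  have "card (U - y ` X) = card (U - z ` X)"
    using U X y z by (simp add: card_Diff_subset card_image)
  then obtain g where g: "bij_betw g (U - y ` X) (U - z ` X)"
    using finite_same_card_bij U by (metis finite_Diff)
  define \<tau> where "\<tau> w = (if w \<in> y ` X then z (the_inv_into X y w) else if w \<in> U then g w else w)" for w
  have \<tau>y: "\<tau> (y x) = z x" if "x \<in> X" for x
    using that y by (auto simp: \<tau>_def the_inv_into_f_f)
  have 1: "bij_betw \<tau> (y ` X) (z ` X)"
    unfolding bij_betw_def
  proof
    show "inj_on \<tau> (y ` X)" using \<tau>y z by (auto simp: inj_on_def)
    show "\<tau> ` y ` X = z ` X" using \<tau>y by (auto simp: image_image)
  qed
  have 2: "bij_betw \<tau> (U - y ` X) (U - z ` X)"
    using g by (subst bij_betw_cong[of _ _ g]) (auto simp: \<tau>_def)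
  have "bij_betw \<tau> (y ` X \<union> (U - y ` X)) (z ` X \<union> (U - z ` X))"
    using 1 2 by (rule bij_betw_combine) auto
  then have "bij_betw \<tau> U U" using U by (simp add: Un_absorb1)
  then show thesis using that[of \<tau>] \<tau>y U by (auto simp: U_def \<tau>_def)
qed

text \<open>The product is the number of injections of an \<open>m\<close>-set into an
  \<open>n\<close>-set.\<close>

lemma falling_factorial_fact:
  fixes m n :: nat
  assumes "m \<le> n"
  shows "(\<Prod>i = 0..<m. n - i) * fact (n - m) = fact n"
  using assms
proof (induction m)
  case (Suc m)
  then have "fact (n - m) = (n - m) * fact (n - Suc m)"
    by (metis Suc_diff_Suc Suc_le_lessD fact_Suc of_nat_id)
  then show ?case using Suc by (simp add: mult.assoc)
qed simp

text \<open>The sets \<open>Nz z\<close> partition \<open>N\<close> according to the values on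
  \<open>X\<close>. Each has at least as many elements as \<open>A\<close>, and there are
  \<open>fact n / fact (n - card X)\<close> of them.\<close>

lemma bijections_lopsided:
  assumes V: "finite V" "card V = n" and X: "X \<subseteq> V" and \<rho>: "\<rho> \<in> bijections V n"
    and T: "\<And>Q. Q \<in> T \<Longrightarrow> fst ` Q \<inter> X = {} \<and> snd ` Q \<inter> \<rho> ` X = {} \<and> fst ` Q \<subseteq> V"
  shows "real (card {\<sigma> \<in> bijections V n. realises \<sigma> (pattern \<rho> X) \<and> (\<forall>Q\<in>T. \<not> realises \<sigma> Q)})
    \<le> fact (n - card X) / fact n * real (card {\<sigma> \<in> bijections V n. \<forall>Q\<in>T. \<not> realises \<sigma> Q})"
proof -
  define A where "A = {\<sigma> \<in> bijections V n. realises \<sigma> (pattern \<rho> X) \<and> (\<forall>Q\<in>T. \<not> realises \<sigma> Q)}"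
  define N where "N = {\<sigma> \<in> bijections V n. \<forall>Q\<in>T. \<not> realises \<sigma> Q}"
  define Z where "Z = {z \<in> X \<rightarrow>\<^sub>E {..<n}. inj_on z X}"
  define Nz where "Nz z = {\<sigma> \<in> N. restrict \<sigma> X = z}" for z
  have finX: "finite X" using V X finite_subset by auto
  have cX: "card X \<le> n" using V X card_mono by blast
  have finN: "finite N" using finite_bijections[OF V(1), of n] by (simp add: N_def)
  have finZ: "finite Z" unfolding Z_def 
    by (rule finite_subset[of _ "X \<rightarrow>\<^sub>E {..<n}"]) (auto intro: finite_PiE finX)
  have \<rho>b: "bij_betw \<rho> V {..<n}" using \<rho> by (simp add: bijections_def)
  \<comment> \<open>Relabelling the points of the image by a permutation that fixes everything outside \<open>\<rho> ` X \<union> z ` X\<close>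
    turns the prescription \<open>\<rho>\<close> on \<open>X\<close> into \<open>z\<close> and cannot create a pattern of \<open>T\<close>.\<close>
  have main: "card A \<le> card (Nz z)" if z: "z \<in> Z" for z
  proof -
    have inj: "inj_on \<rho> X" "inj_on z X"
      using \<rho>b z X by (auto simp: Z_def bij_betw_def intro: inj_on_subset)
    obtain \<tau> where \<tau>: "bij_betw \<tau> (\<rho> ` X \<union> z ` X) (\<rho> ` X \<union> z ` X)"
      "\<And>x. x \<in> X \<Longrightarrow> \<tau> (\<rho> x) = z x" "\<And>w. w \<notin> \<rho> ` X \<union> z ` X \<Longrightarrow> \<tau> w = w"
      using bij_moving_injection[OF finX inj] by metis
    have sub: "\<rho> ` X \<union> z ` X \<subseteq> {..<n}"
      using \<rho>b z X by (auto simp: Z_def bij_betw_def)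
    have "bij_betw \<tau> ({..<n} - (\<rho> ` X \<union> z ` X)) ({..<n} - (\<rho> ` X \<union> z ` X))"
      by (subst bij_betw_cong[of _ _ id]) (use \<tau>(3) in auto)
    from bij_betw_combine[OF \<tau>(1) this] have \<tau>n: "bij_betw \<tau> {..<n} {..<n}"
      using sub by (simp add: Un_absorb1)
    define F where "F \<sigma> = restrict (\<tau> \<circ> \<sigma>) V" for \<sigma> :: "'a \<Rightarrow> nat"
    have Fb: "F \<sigma> \<in> bijections V n" if "\<sigma> \<in> bijections V n" for \<sigma>
    proof -
      have "bij_betw (\<tau> \<circ> \<sigma>) V {..<n}"
        using that \<tau>n by (auto simp: bijections_def intro: bij_betw_trans)
      then have "bij_betw (F \<sigma>) V {..<n}" unfolding F_def by (simp cong: bij_betw_cong)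
      then show ?thesis
        unfolding bijections_def by (auto simp: F_def bij_betw_def)
    qed
    have "F ` A \<subseteq> Nz z"
    proof
      fix \<sigma>' assume "\<sigma>' \<in> F ` A"
      then obtain \<sigma> where \<sigma>: "\<sigma> \<in> A" "\<sigma>' = F \<sigma>" by blast
      have \<sigma>b: "\<sigma> \<in> bijections V n" and \<sigma>\<rho>: "\<And>x. x \<in> X \<Longrightarrow> \<sigma> x = \<rho> x"
        using \<sigma> by (auto simp: A_def realises_pattern)
      have F: "F \<sigma> \<in> bijections V n" using Fb \<sigma>b .
      have Fz: "F \<sigma> x = z x" if "x \<in> X" for x
        using that X \<sigma>\<rho> \<tau>(2) by (auto simp: F_def)
      have "\<not> realises (F \<sigma>) Q" if Q: "Q \<in> T" for Q
      proof
        assume r: "realises (F \<sigma>) Q"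
        have "\<sigma> x = w" if xw: "(x, w) \<in> Q" for x w
        proof -
          have x: "x \<in> V" "x \<notin> X" "w \<notin> \<rho> ` X" "F \<sigma> x = w"
            using T[OF Q] xw r by (force simp: realises_def)+
          have inF: "inj_on (F \<sigma>) V" using F by (auto simp: bijections_def bij_betw_def)
          have "w \<notin> z ` X"
          proof
            assume "w \<in> z ` X"
            then obtain x' where "x' \<in> X" "F \<sigma> x' = F \<sigma> x" using Fz x by auto
            then show False using inF x X by (metis inj_onD subsetD)
          qed
          then have w: "w \<notin> \<rho> ` X \<union> z ` X" using x by blast
          \<comment> \<open>Since \<open>\<tau>\<close> fixes \<open>w\<close>, injectivity of
            \<open>\<tau>\<close> shows that \<open>\<sigma>\<close> took the value \<open>w\<close>
            at \<open>x\<close> before the relabelling.\<close>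
          have "\<tau> (\<sigma> x) = \<tau> w" using x \<tau>(3)[OF w] by (simp add: F_def)
          moreover have "\<sigma> x \<in> {..<n}" "w \<in> {..<n}"
            using \<sigma>b x F by (auto simp: bijections_def)
          ultimately show ?thesis using \<tau>n by (metis bij_betw_def inj_onD)
        qed
        then have "realises \<sigma> Q" by (auto simp: realises_def)
        then show False using \<sigma> Q by (auto simp: A_def)
      qed
      \<comment> \<open>Equality of functions also concerns points outside \<open>X\<close>, where
        both sides are \<open>undefined\<close>.\<close>
      moreover have "restrict (F \<sigma>) X = z"
      proof
        fix x
        show "restrict (F \<sigma>) X x = z x"
          using Fz z PiE_arb[of z X "\<lambda>_. {..<n}" x] by (cases "x \<in> X") (simp_all add: Z_def)
      qed
      ultimately show "\<sigma>' \<in> Nz z" using F \<sigma> by (auto simp: Nz_def N_def)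
    qed
    moreover have "inj_on F A"
    proof (rule inj_onI)
      fix \<sigma> \<sigma>' assume *: "\<sigma> \<in> A" "\<sigma>' \<in> A" "F \<sigma> = F \<sigma>'"
      then have e: "\<sigma> \<in> V \<rightarrow>\<^sub>E {..<n}" "\<sigma>' \<in> V \<rightarrow>\<^sub>E {..<n}" by (auto simp: A_def bijections_def)
      have "\<sigma> x = \<sigma>' x" if "x \<in> V" for x
      proof -
        have "\<tau> (\<sigma> x) = \<tau> (\<sigma>' x)" using *(3) that by (auto simp: F_def fun_eq_iff split: if_splits)
        moreover have "\<sigma> x \<in> {..<n}" "\<sigma>' x \<in> {..<n}" using e that by auto
        ultimately show ?thesis using \<tau>n by (metis bij_betw_def inj_onD)
      qed
      then show "\<sigma> = \<sigma>'" using e by (rule PiE_ext[rotated 2])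
    qed
    moreover have "finite (Nz z)" using finN by (auto simp: Nz_def)
    ultimately show ?thesis by (metis card_image card_mono)
  qed
  have "N = (\<Union>z\<in>Z. Nz z)"
  proof -
    have "restrict \<sigma> X \<in> Z" if "\<sigma> \<in> N" for \<sigma>
    proof -
      have "\<sigma> \<in> V \<rightarrow>\<^sub>E {..<n}" "inj_on \<sigma> V"
        using that by (simp_all add: N_def bijections_def bij_betw_def)
      moreover from this have "inj_on \<sigma> X" using X inj_on_subset by blast
      ultimately show ?thesis using X by (auto simp: Z_def PiE_iff)
    qed
    then show ?thesis by (auto simp: Nz_def)
  qed
  moreover have "card (\<Union>z\<in>Z. Nz z) = (\<Sum>z\<in>Z. card (Nz z))"
    by (rule card_UN_disjoint) (use finN finZ in \<open>auto simp: Nz_def\<close>)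
  ultimately have "card N = (\<Sum>z\<in>Z. card (Nz z))" by metis
  also have "\<dots> \<ge> (\<Sum>z\<in>Z. card A)" by (intro sum_mono main)
  finally have "card Z * card A \<le> card N" by simp
  moreover have "real (card Z) = fact n / fact (n - card X)"
  proof -
    have "card Z = (\<Prod>i = 0..<card X. n - i)"
      using card_inj_on_subset_funcset[of X "{..<n}" X] finX by (simp add: Z_def)
    then show ?thesis using falling_factorial_fact[OF cX]
      by (metis fact_nonzero nonzero_eq_divide_eq of_nat_fact of_nat_mult)
  qed
  ultimately have "fact n / fact (n - card X) * real (card A) \<le> real (card N)"
    by (metis of_nat_le_iff of_nat_mult)
  then show ?thesis unfolding A_def[symmetric] N_def[symmetric]
    by (simp add: field_simps)
qed

section \<open>Union bound and degree sum\<close>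

text \<open>An element lying in several \<open>A i\<close> is counted once on the left and once for
  each such \<open>i\<close> on the right.\<close>

lemma sum_UN_le:
  fixes f :: "'b \<Rightarrow> real"
  assumes "finite I" "\<And>i. i \<in> I \<Longrightarrow> finite (A i)" "\<And>i x. i \<in> I \<Longrightarrow> x \<in> A i \<Longrightarrow> 0 \<le> f x"
  shows "sum f (\<Union>i\<in>I. A i) \<le> (\<Sum>i\<in>I. sum f (A i))"
proof -
  have "sum f (\<Union>i\<in>I. A i) \<le> (\<Sum>(i, x)\<in>Sigma I A. f x)"
    by (rule sum_le_included[where i = snd]) (use assms in force)+
  also have "\<dots> = (\<Sum>i\<in>I. sum f (A i))"
    using assms by (simp add: sum.Sigma)
  finally show ?thesis .
qed

lemma nsets_two_iff: "e \<in> nsets A 2 \<longleftrightarrow> e \<subseteq> A \<and> card e = 2"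
  by (auto simp: nsets_def intro: card_ge_0_finite)

text \<open>Handshake lemma: incidences are counted from both sides, each edge having two
  ends.\<close>

lemma degree_sum:
  assumes "finite V" "E \<subseteq> nsets V 2"
  shows "(\<Sum>v\<in>V. degree E v) = 2 * card E"
proof -
  have "finite E" using assms finite_imp_finite_nsets finite_subset by metis
  moreover have "{v \<in> V. v \<in> e} = e" if "e \<in> E" for e
  proof -
    have "e \<subseteq> V" using that assms(2) nsets_two_iff[of e V] by blast
    then show ?thesis by blast
  qed
  ultimately show ?thesis
    unfolding degree_def using assms
    by (intro sum_multicount) (auto simp: nsets_two_iff)
qed

section \<open>Patterns of two edges with prescribed images\<close>

text \<open>The images of the edges are prescribed only as sets, so one choice of \<open>e'\<close>
  and \<open>f'\<close> may admit several patterns, according to how the edges are oriented.\<close>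

definition pair_patterns ::
    "'a set \<Rightarrow> nat \<Rightarrow> 'a set \<Rightarrow> 'a set \<Rightarrow> nat set \<Rightarrow> nat set \<Rightarrow> ('a \<times> nat) set set" where
  "pair_patterns V n e f e' f' =
    (\<lambda>\<sigma>. pattern \<sigma> (e \<union> f)) ` {\<sigma> \<in> bijections V n. \<sigma> ` e = e' \<and> \<sigma> ` f = f'}"

lemma finite_pair_patterns: "finite V \<Longrightarrow> finite (pair_patterns V n e f e' f')"
  by (simp add: pair_patterns_def finite_bijections)

lemma card_in_pair_patterns: "Q \<in> pair_patterns V n e f e' f' \<Longrightarrow> card Q = card (e \<union> f)"
  by (auto simp: pair_patterns_def)

lemma inj_on_bijections: "\<sigma> \<in> bijections V n \<Longrightarrow> inj_on \<sigma> V"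
  by (simp add: bijections_def bij_betw_def)

text \<open>An injective map sends the intersection of two edges onto the intersection of their
  images.\<close>

lemma pair_patterns_empty:
  assumes "e \<in> nsets V 2" "f \<in> nsets V 2" "(e \<inter> f = {}) \<noteq> (e' \<inter> f' = {})"
  shows "pair_patterns V n e f e' f' = {}"
proof -
  have "(e' \<inter> f' = {}) = (e \<inter> f = {})"
    if "\<sigma> \<in> bijections V n" "\<sigma> ` e = e'" "\<sigma> ` f = f'" for \<sigma>
  proof -
    have "\<sigma> ` (e \<inter> f) = e' \<inter> f'"
      using that assms inj_on_image_Int[OF inj_on_bijections, of \<sigma> V n e f]
      by (simp add: nsets_two_iff)
    then show ?thesis by (metis image_is_empty)
  qed
  then show ?thesis using assms(3) by (auto simp: pair_patterns_def)
qed

text \<open>The common end of the edges must go to the common point of the images, which then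
  determines where the other two ends go.\<close>

lemma card_pair_patterns_adjacent:
  assumes V: "finite V" and ef: "e \<in> nsets V 2" "f \<in> nsets V 2" "e \<noteq> f" "e \<inter> f \<noteq> {}"
  shows "card (pair_patterns V n e f e' f') \<le> 1" "card (e \<union> f) = 3"
proof -
  obtain a where a: "a \<in> e" "a \<in> f" using ef by auto
  obtain b where b: "e = {a, b}" "a \<noteq> b"
    using a ef(1) by (auto simp: nsets_two_iff card_2_iff)
  obtain c where c: "f = {a, c}" "a \<noteq> c"
    using a ef(2) by (auto simp: nsets_two_iff card_2_iff)
  have bc: "b \<noteq> c" using b c ef by auto
  show "card (e \<union> f) = 3" using b c bc by (simp add: insert_commute)
  have abc: "a \<in> V" "b \<in> V" "c \<in> V" using b c ef by (auto simp: nsets_two_iff)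
  have "pattern \<sigma> (e \<union> f) = pattern \<tau> (e \<union> f)"
    if \<sigma>: "\<sigma> \<in> bijections V n" "\<sigma> ` e = e'" "\<sigma> ` f = f'"
      and \<tau>: "\<tau> \<in> bijections V n" "\<tau> ` e = e'" "\<tau> ` f = f'" for \<sigma> \<tau>
  proof -
    \<comment> \<open>If the two maps differed at \<open>a\<close>, then \<open>\<tau> b\<close> and
      \<open>\<tau> c\<close> would both equal \<open>\<sigma> a\<close>.\<close>
    have "\<sigma> b \<noteq> \<sigma> c" "\<tau> b \<noteq> \<tau> c"
      using \<sigma> \<tau> abc bc inj_on_bijections[of _ V n] by (metis inj_onD)+
    moreover have "{\<sigma> a, \<sigma> b} = {\<tau> a, \<tau> b}" "{\<sigma> a, \<sigma> c} = {\<tau> a, \<tau> c}"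
      using \<sigma> \<tau> b c by auto
    ultimately have "\<sigma> a = \<tau> a \<and> \<sigma> b = \<tau> b \<and> \<sigma> c = \<tau> c"
      by (auto simp: doubleton_eq_iff)
    then show ?thesis using b c by (simp add: pattern_def)
  qed
  then have "\<forall>Q\<in>pair_patterns V n e f e' f'. \<forall>Q'\<in>pair_patterns V n e f e' f'. Q = Q'"
    unfolding pair_patterns_def by blast
  then show "card (pair_patterns V n e f e' f') \<le> 1"
    using card_le_Suc0_iff_eq[OF finite_pair_patterns[OF V]] by simp
qed

text \<open>Each of the two edges can be mapped onto its image in at most two ways, independently of
  the other.\<close>

lemma card_pair_patterns_disjoint:
  assumes V: "finite V" and ef: "e \<in> nsets V 2" "f \<in> nsets V 2" "e \<inter> f = {}"
  shows "card (pair_patterns V n e f e' f') \<le> 4" "card (e \<union> f) = 4"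
proof -
  have "finite e" "finite f" using ef V by (auto simp: nsets_def)
  then show "card (e \<union> f) = 4" using ef by (simp add: card_Un_disjoint nsets_two_iff)
  obtain a b where ab: "e = {a, b}" using ef(1) by (auto simp: nsets_two_iff card_2_iff)
  obtain c d where cd: "f = {c, d}" using ef(2) by (auto simp: nsets_two_iff card_2_iff)
  show "card (pair_patterns V n e f e' f') \<le> 4"
  proof (cases "pair_patterns V n e f e' f' = {}")
    case False
    then obtain \<rho> where "\<rho> ` e = e'" "\<rho> ` f = f'" by (auto simp: pair_patterns_def)
    then obtain p q r s where pqrs: "e' = {p, q}" "f' = {r, s}" using ab cd by auto
    define S where "S = {{(a,p),(b,q),(c,r),(d,s)}, {(a,q),(b,p),(c,r),(d,s)},
      {(a,p),(b,q),(c,s),(d,r)}, {(a,q),(b,p),(c,s),(d,r)}}"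
    have "pattern \<sigma> (e \<union> f) \<in> S" if "\<sigma> ` e = e'" "\<sigma> ` f = f'" for \<sigma>
    proof -
      have "{\<sigma> a, \<sigma> b} = {p, q}" "{\<sigma> c, \<sigma> d} = {r, s}" using that ab cd pqrs by auto
      moreover have "pattern \<sigma> (e \<union> f) = {(a, \<sigma> a), (b, \<sigma> b), (c, \<sigma> c), (d, \<sigma> d)}"
        using ab cd by (auto simp: pattern_def)
      ultimately show ?thesis unfolding doubleton_eq_iff S_def by (elim disjE conjE) simp_all
    qed
    then have "pair_patterns V n e f e' f' \<subseteq> S" by (auto simp: pair_patterns_def)
    then have "card (pair_patterns V n e f e' f') \<le> card S"
      by (rule card_mono[rotated]) (simp add: S_def)
    also have "card S \<le> 4" by (simp add: S_def card_insert_if)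
    finally show ?thesis .
  qed simp
qed

section \<open>Total probability of families of patterns\<close>

text \<open>The probability that a uniform bijection realises an injective pattern: the remaining
  \<open>n - card Q\<close> points can be matched arbitrarily.\<close>

definition pattern_prob :: "nat \<Rightarrow> ('a \<times> nat) set \<Rightarrow> real" where
  "pattern_prob n Q = fact (n - card Q) / fact n"

text \<open>Only adjacent pairs of edges can be mapped to adjacent pairs; such patterns have larger
  probability than those of disjoint pairs, by a factor of order \<open>n\<close>, but there are fewer of them,
  so that one bound serves both cases.\<close>

lemma sum_pattern_prob_le:
  assumes V: "finite V" "card V = n" and E: "E \<subseteq> nsets V 2" and n: "4 \<le> n"
    and deg: "\<And>v. v \<in> V \<Longrightarrow> degree E v \<le> \<Delta>" and e: "e \<in> E"
  shows "(\<Sum>f\<in>E - {e}. \<Sum>Q\<in>pair_patterns V n e f e' f'. pattern_prob n Q)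
    \<le> 2 * real n * real \<Delta> * (fact (n - 4) / fact n)"
proof -
  define p4 :: real where "p4 = fact (n - 4) / fact n"
  have p4: "p4 \<ge> 0" by (simp add: p4_def)
  have "(fact (n - 3) :: real) = real (n - 3) * fact (n - 4)"
  proof -
    have "n - 3 = Suc (n - 4)" using n by simp
    then show ?thesis by simp
  qed
  then have p3: "fact (n - 3) / fact n \<le> real n * p4"
    by (simp add: p4_def divide_right_mono mult_right_mono)
  have finE: "finite E" using V E finite_imp_finite_nsets finite_subset by metis
  let ?s = "\<lambda>f. \<Sum>Q\<in>pair_patterns V n e f e' f'. pattern_prob n Q"
  have s: "?s f = real (card (pair_patterns V n e f e' f')) * (fact (n - card (e \<union> f)) / fact n)" for f
    by (simp add: pattern_prob_def card_in_pair_patterns)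
  show ?thesis
  proof (cases "e' \<inter> f' = {}")
    case True
    have "?s f \<le> 4 * p4" if f: "f \<in> E - {e}" for f
    proof (cases "e \<inter> f = {}")
      case T: True
      have "card (pair_patterns V n e f e' f') \<le> 4" "card (e \<union> f) = 4"
        using card_pair_patterns_disjoint[OF V(1)] T e f E by blast+
      then show ?thesis unfolding s p4_def by (intro mult_mono) auto
    next
      case F: False
      then have "pair_patterns V n e f e' f' = {}"
        using True e f E by (intro pair_patterns_empty) auto
      then show ?thesis using p4 by simp
    qed
    then have "(\<Sum>f\<in>E - {e}. ?s f) \<le> (\<Sum>f\<in>E - {e}. 4 * p4)" by (rule sum_mono)
    also have "\<dots> \<le> (\<Sum>f\<in>E. 4 * p4)" using finE p4 by (intro sum_mono2) auto
    \<comment> \<open>The factor 4 is split so that \<open>2 * card E\<close> can be replaced by the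
      degree sum, which is at most \<open>n * \<Delta>\<close>.\<close>
    also have "\<dots> = 2 * real (2 * card E) * p4" by simp
    also have "2 * card E = (\<Sum>v\<in>V. degree E v)" using degree_sum V E by metis
    also have "2 * real (\<Sum>v\<in>V. degree E v) * p4 \<le> 2 * real (n * \<Delta>) * p4"
    proof -
      have "(\<Sum>v\<in>V. degree E v) \<le> n * \<Delta>"
        using sum_bounded_above[of V "degree E" \<Delta>] deg V by simp
      then show ?thesis using p4 by (intro mult_right_mono) (auto simp del: of_nat_mult of_nat_sum)
    qed
    finally show ?thesis by (simp add: p4_def)
  next
    case False
    obtain a b where ab: "e = {a, b}" "a \<in> V" "b \<in> V" "a \<noteq> b"
    proof -
      have "e \<subseteq> V" "card e = 2" using e E nsets_two_iff[of e V] by blast+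
      then show ?thesis using that by (auto simp: card_2_iff)
    qed
    \<comment> \<open>Only edges meeting \<open>e\<close> contribute here. There are at most
      \<open>2 * \<Delta>\<close> of them, each with at most one pattern of probability at most
      \<open>n * p4\<close>, which gives the same total as in the disjoint case.\<close>
    define D where "D = {f \<in> E. a \<in> f} \<union> {f \<in> E. b \<in> f}"
    have "card D \<le> card {f \<in> E. a \<in> f} + card {f \<in> E. b \<in> f}"
      unfolding D_def by (rule card_Un_le)
    also have "\<dots> \<le> 2 * \<Delta>" using deg[of a] deg[of b] ab by (simp add: degree_def)
    finally have cD: "card D \<le> 2 * \<Delta>" .
    have "?s f \<le> (if f \<in> D then real n * p4 else 0)" if f: "f \<in> E - {e}" for f
    proof (cases "e \<inter> f = {}")
      case T: True
      then have "pair_patterns V n e f e' f' = {}"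
        using False e f E by (intro pair_patterns_empty) auto
      then show ?thesis using p4 by simp
    next
      case F: False
      then have "f \<in> D" using ab f by (auto simp: D_def)
      moreover have "card (pair_patterns V n e f e' f') \<le> 1" "card (e \<union> f) = 3"
        using card_pair_patterns_adjacent[OF V(1), of e f] F e f E by blast+
      then have "?s f \<le> 1 * (fact (n - 3) / fact n)" unfolding s by (intro mult_mono) auto
      ultimately show ?thesis using p3 by simp
    qed
    then have "(\<Sum>f\<in>E - {e}. ?s f) \<le> (\<Sum>f\<in>E - {e}. if f \<in> D then real n * p4 else 0)"
      by (rule sum_mono)
    also have "\<dots> \<le> (\<Sum>f\<in>E. if f \<in> D then real n * p4 else 0)"
      using finE p4 by (intro sum_mono2) auto
    also have "\<dots> = real (card (E \<inter> D)) * (real n * p4)"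
      using finE by (simp add: sum.If_cases Collect_conj_eq[symmetric] Int_def)
    also have "E \<inter> D = D" by (auto simp: D_def)
    also have "real (card D) * (real n * p4) \<le> real (2 * \<Delta>) * (real n * p4)"
      using cD p4 by (intro mult_right_mono) (auto simp del: of_nat_mult)
    finally show ?thesis by (simp add: p4_def mult_ac)
  qed
qed

text \<open>Union bound over the first edge, the pair of images and the second edge. For patterns
  through a vertex, \<open>D\<close> will be the edges at that vertex and \<open>M\<close> all
  monochromatic pairs; for patterns through an image point, \<open>D\<close> will be
  \<open>E\<close> and \<open>M\<close> the pairs whose first edge contains that point.\<close>

lemma sum_pattern_prob_UN_le:
  assumes V: "finite V" "card V = n" and E: "E \<subseteq> nsets V 2" and n: "4 \<le> n"
    and deg: "\<And>v. v \<in> V \<Longrightarrow> degree E v \<le> \<Delta>"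
    and D: "D \<subseteq> E" and M: "finite M"
    and R: "\<And>Q. Q \<in> R \<Longrightarrow>
      \<exists>e\<in>D. \<exists>(e', f')\<in>M. \<exists>f\<in>E - {e}. Q \<in> pair_patterns V n e f e' f'"
  shows "(\<Sum>Q\<in>R. pattern_prob n Q)
    \<le> real (card D) * real (card M) * (2 * real n * real \<Delta> * (fact (n - 4) / fact n))"
proof -
  let ?P = "\<lambda>e m f. pair_patterns V n e f (fst m) (snd m)"
  have fin: "finite E" "finite D"
    using V E D finite_imp_finite_nsets finite_subset by metis+
  have finP: "finite (?P e m f)" for e m f using V by (simp add: finite_pair_patterns)
  have nn: "0 \<le> pattern_prob n Q" for Q :: "('a \<times> nat) set" by (simp add: pattern_prob_def)
  have "R \<subseteq> (\<Union>e\<in>D. \<Union>m\<in>M. \<Union>f\<in>E - {e}. ?P e m f)" using R by fastforce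
  then have "sum (pattern_prob n) R \<le> sum (pattern_prob n) (\<Union>e\<in>D. \<Union>m\<in>M. \<Union>f\<in>E - {e}. ?P e m f)"
    using fin M finP nn by (intro sum_mono2) auto
  also have "\<dots> \<le> (\<Sum>e\<in>D. sum (pattern_prob n) (\<Union>m\<in>M. \<Union>f\<in>E - {e}. ?P e m f))"
    using fin M finP nn by (intro sum_UN_le) auto
  also have "\<dots> \<le> (\<Sum>e\<in>D. \<Sum>m\<in>M. sum (pattern_prob n) (\<Union>f\<in>E - {e}. ?P e m f))"
    using fin M finP nn by (intro sum_mono sum_UN_le) auto
  also have "\<dots> \<le> (\<Sum>e\<in>D. \<Sum>m\<in>M. \<Sum>f\<in>E - {e}. sum (pattern_prob n) (?P e m f))"
    using fin M finP nn by (intro sum_mono sum_UN_le) auto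
  also have "\<dots> \<le> (\<Sum>e\<in>D. \<Sum>m\<in>M. 2 * real n * real \<Delta> * (fact (n - 4) / fact n))"
    using D by (intro sum_mono sum_pattern_prob_le V E n deg) auto
  finally show ?thesis by simp
qed

section \<open>Monochromatic pairs and the numerical estimate\<close>

text \<open>The pairs are ordered, so that either edge of a pattern can be taken as the
  first.\<close>

definition monochromatic_pairs :: "('b set \<Rightarrow> 'c) \<Rightarrow> 'b set set \<Rightarrow> ('b set \<times> 'b set) set" where
  "monochromatic_pairs \<chi> K = {(e, f). e \<in> K \<and> f \<in> K \<and> \<chi> e = \<chi> f}"

text \<open>The partners of a fixed first edge form its colour class, which has at most
  \<open>k\<close> elements.\<close>

lemma card_monochromatic_pairs_le:
  assumes K: "finite K" and \<chi>: "bounded_colouring k K \<chi>" and L: "L \<subseteq> K"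
  shows "card {m \<in> monochromatic_pairs \<chi> K. fst m \<in> L} \<le> card L * k"
proof -
  have "{m \<in> monochromatic_pairs \<chi> K. fst m \<in> L} = (SIGMA e:L. {f \<in> K. \<chi> f = \<chi> e})"
    using L by (auto simp: monochromatic_pairs_def)
  moreover have "finite L" using K L finite_subset by blast
  ultimately have "card {m \<in> monochromatic_pairs \<chi> K. fst m \<in> L} = (\<Sum>e\<in>L. card {f \<in> K. \<chi> f = \<chi> e})"
    using K by simp
  also have "\<dots> \<le> card L * k"
    using sum_bounded_above[of L _ k] \<chi> by (simp add: bounded_colouring_def)
  finally show ?thesis .
qed

lemma card_nsets_two_containing_le:
  assumes "finite A" "x \<in> A"
  shows "card {e \<in> nsets A 2. x \<in> e} \<le> card A - 1"
proof -
  have "{e \<in> nsets A 2. x \<in> e} \<subseteq> (\<lambda>y. {x, y}) ` (A - {x})"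
    by (auto simp: nsets_two_iff card_2_iff)
  then have "card {e \<in> nsets A 2. x \<in> e} \<le> card (A - {x})"
    using assms by (meson card_image_le card_mono finite_Diff finite_imageI order_trans)
  then show ?thesis using assms by simp
qed

lemma fact_diff_4:
  assumes "4 \<le> n"
  shows "(fact (n - 4) :: real) / fact n
    = 1 / (real n * (real n - 1) * (real n - 2) * (real n - 3))"
proof -
  obtain m where m: "n = m + 4" using assms by (metis add.commute le_Suc_ex)
  have "(fact n :: real) = (real m + 4) * (real m + 3) * (real m + 2) * (real m + 1) * fact m"
    by (simp add: m eval_nat_numeral algebra_simps)
  then show ?thesis by (simp add: m add.commute)
qed

text \<open>The left side simplifies to
  \<open>\<Delta>\<^sup>2 * k * n / ((n - 2) * (n - 3))\<close>, and the hypothesis bounds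
  \<open>\<Delta>\<^sup>2 * k\<close> by \<open>n / 51\<close>. The target 1/32 is the allowance 1/4
  shared among four domain points and four image points.\<close>

lemma weight_numeric_bound:
  fixes n \<Delta> k :: nat
  assumes n: "51 \<le> n" and k: "51 * (real \<Delta>)\<^sup>2 * real k \<le> real n"
  shows "real \<Delta> * (real n * (real n - 1) / 2 * real k) * (2 * real n * real \<Delta> * (fact (n - 4) / fact n)) \<le> 1/32"
proof -
  define x where "x = real n"
  have x: "x \<ge> 51" using n by (simp add: x_def)
  have "real \<Delta> * (x * (x - 1) / 2 * real k) * (2 * x * real \<Delta> * (1 / (x * (x - 1) * (x - 2) * (x - 3))))
     = (real \<Delta>)\<^sup>2 * real k * x / ((x - 2) * (x - 3))"
    using x by (simp add: power2_eq_square)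
  also have "\<dots> \<le> (x / 51) * x / ((x - 2) * (x - 3))"
    using k x by (intro divide_right_mono mult_right_mono) (auto simp: x_def)
  also have "\<dots> \<le> 1/32"
  proof -
    \<comment> \<open>After subtracting \<open>32 / 51 * x\<^sup>2\<close>, the remaining
      \<open>19 / 51 * x\<^sup>2\<close> is at least \<open>19 * x\<close> and absorbs the term
      \<open>5 * x\<close>.\<close>
    have "51 * x \<le> x * x" using x by (intro mult_right_mono) auto
    moreover have "(x - 2) * (x - 3) = x * x - 5 * x + 6" by (simp add: algebra_simps)
    moreover have "32 * (x / 51 * x) = 32 / 51 * (x * x)" by simp
    ultimately have "32 * (x / 51 * x) \<le> (x - 2) * (x - 3)" using x by linarith
    then show ?thesis using x by (simp add: divide_simps)
  qed
  finally show ?thesis using fact_diff_4[of n] n by (simp add: x_def)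
qed

section \<open>The local lemma applied to monochromatic patterns\<close>

theorem theorem7:
  fixes V :: "'a set" and E :: "'a set set" and n \<Delta> k :: nat
    and \<chi> :: "nat set \<Rightarrow> 'c"
  assumes "simple_graph V E"
    and "card V = n"
    and "max_degree V E = \<Delta>"
    and "\<Delta> > 0"
    and "real k \<le> real n / (51 * (real \<Delta>)\<^sup>2)"
    and "bounded_colouring k (complete_edges n) \<chi>"
  shows "graph_rainbow V E n \<chi>"
proof -
  have V: "finite V" "card V = n" and E: "E \<subseteq> nsets V 2"
    using assms by (auto simp: simple_graph_def)
  have finE: "finite E" using V E finite_imp_finite_nsets finite_subset by metis
  have deg: "degree E v \<le> \<Delta>" if "v \<in> V" for v
    using assms(3) V that unfolding max_degree_def
    by (metis Max_ge finite_imageI finite_insert imageI insertI2)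
  define K where "K = complete_edges n"
  have K: "K = nsets {..<n} 2" by (simp add: K_def complete_edges_def complete_verts_def)
  have finK: "finite K" by (simp add: K finite_imp_finite_nsets)
  have \<chi>: "bounded_colouring k K \<chi>" using assms(6) by (simp add: K_def)
  \<comment> \<open>The hypotheses force \<open>51 \<le> n\<close>: since
    \<open>\<Delta> > 0\<close> there is an edge, hence \<open>2 \<le> n\<close>; the colour class
    of \<open>{0, 1}\<close> is then nonempty, so \<open>k > 0\<close>, and the bound on
    \<open>k\<close> gives the claim.\<close>
  have "E \<noteq> {}"
  proof
    assume "E = {}"
    then have "insert 0 (degree E ` V) = {0}" by (auto simp: degree_def)
    then show False using assms(3,4) unfolding max_degree_def by (metis Max_singleton less_irrefl)
  qed
  then obtain e0 where "e0 \<in> E" by blast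
  then have "e0 \<subseteq> V" "card e0 = 2" using E nsets_two_iff[of e0 V] by blast+
  then have "2 \<le> n" using V card_mono by metis
  then have "{0, 1} \<in> K" by (simp add: K nsets_two_iff)
  then have "card {e \<in> K. \<chi> e = \<chi> {0, 1}} > 0" using finK by (auto simp: card_gt_0_iff)
  then have "k > 0" using \<chi> unfolding bounded_colouring_def by (metis gr0I le_zero_eq less_irrefl)
  have k: "51 * (real \<Delta>)\<^sup>2 * real k \<le> real n"
    using assms(4,5) by (simp add: field_simps)
  have "1 \<le> (real \<Delta>)\<^sup>2 * real k"
    using mult_mono[of 1 "(real \<Delta>)\<^sup>2" 1 "real k"] \<open>k > 0\<close> assms(4) by simp
  then have n: "51 \<le> n" using k by linarith

  define \<Omega> where "\<Omega> = bijections V n"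
  define I where "I = {pattern \<sigma> (e \<union> f) | \<sigma> e f.
    \<sigma> \<in> \<Omega> \<and> e \<in> E \<and> f \<in> E \<and> e \<noteq> f \<and> \<chi> (\<sigma> ` e) = \<chi> (\<sigma> ` f)}"
  \<comment> \<open>Non-neighbours are exactly the patterns with disjoint domains and disjoint
    images, as \<open>bijections_lopsided\<close> requires.\<close>
  define nb :: "('a \<times> nat) set \<Rightarrow> ('a \<times> nat) set \<Rightarrow> bool" where
    "nb P Q \<longleftrightarrow> fst ` P \<inter> fst ` Q \<noteq> {} \<or> snd ` P \<inter> snd ` Q \<noteq> {}" for P Q
  define M where "M = monochromatic_pairs \<chi> K"
  have finM: "finite M"
    unfolding M_def monochromatic_pairs_def by (rule finite_subset[of _ "K \<times> K"]) (use finK in auto)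
  have image_K: "\<sigma> ` e \<in> K" if "\<sigma> \<in> \<Omega>" "e \<in> E" for \<sigma> e
  proof -
    have "e \<subseteq> V" "card e = 2" using that E nsets_two_iff[of e V] by blast+
    moreover have "inj_on \<sigma> V" "\<sigma> ` V = {..<n}"
      using that by (simp_all add: \<Omega>_def bijections_def bij_betw_def)
    ultimately show ?thesis
      unfolding K nsets_two_iff by (metis card_image image_mono inj_on_subset)
  qed
  have I_D: "\<exists>\<sigma>\<in>\<Omega>. \<exists>e\<in>E. \<exists>f\<in>E. e \<noteq> f \<and> \<chi> (\<sigma> ` e) = \<chi> (\<sigma> ` f) \<and> Q = pattern \<sigma> (e \<union> f)"
    if "Q \<in> I" for Q
    using that unfolding I_def by auto
  \<comment> \<open>Patterns and equality of colours are symmetric in the two edges, so the edge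
    through \<open>z\<close> may be taken first.\<close>
  have I_cases: "\<exists>\<sigma> e f. \<sigma> \<in> \<Omega> \<and> e \<in> E \<and> f \<in> E - {e} \<and> (\<sigma> ` e, \<sigma> ` f) \<in> M \<and> Q = pattern \<sigma> (e \<union> f) \<and>
      Q \<in> pair_patterns V n e f (\<sigma> ` e) (\<sigma> ` f) \<and> z \<in> e"
    if Q: "Q \<in> I" and z: "z \<in> fst ` Q" for Q z
  proof -
    obtain \<sigma> e f where *: "\<sigma> \<in> \<Omega>" "e \<in> E" "f \<in> E" "e \<noteq> f" "\<chi> (\<sigma> ` e) = \<chi> (\<sigma> ` f)"
      "Q = pattern \<sigma> (e \<union> f)"
      using I_D[OF Q] by blast
    have "z \<in> e \<or> z \<in> f" using z * by simp
    moreover have "(\<sigma> ` e, \<sigma> ` f) \<in> M" "(\<sigma> ` f, \<sigma> ` e) \<in> M"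
      using * image_K by (simp_all add: M_def monochromatic_pairs_def)
    moreover have "Q \<in> pair_patterns V n e f (\<sigma> ` e) (\<sigma> ` f)" "Q = pattern \<sigma> (f \<union> e)"
      "Q \<in> pair_patterns V n f e (\<sigma> ` f) (\<sigma> ` e)"
      using * by (auto simp: pair_patterns_def \<Omega>_def Un_commute)
    ultimately show ?thesis using * by blast
  qed
  have I_V: "fst ` Q \<subseteq> V" if Q: "Q \<in> I" for Q
  proof -
    obtain \<sigma> e f where "\<sigma> \<in> \<Omega>" "e \<in> E" "f \<in> E" "Q = pattern \<sigma> (e \<union> f)"
      using I_D[OF Q] by blast
    moreover from this have "e \<subseteq> V" "f \<subseteq> V"
      using E nsets_two_iff[of e V] nsets_two_iff[of f V] by blast+
    ultimately show ?thesis by simp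
  qed
  have I_n: "snd ` Q \<subseteq> {..<n}" if Q: "Q \<in> I" for Q
  proof -
    obtain \<sigma> e f where "\<sigma> \<in> \<Omega>" "e \<in> E" "f \<in> E" "Q = pattern \<sigma> (e \<union> f)"
      using I_D[OF Q] by blast
    moreover from this have "\<sigma> ` e \<subseteq> {..<n}" "\<sigma> ` f \<subseteq> {..<n}"
      using image_K[of \<sigma> e] image_K[of \<sigma> f] by (simp_all add: K nsets_two_iff)
    ultimately show ?thesis by (simp add: image_Un)
  qed
  have finI: "finite I"
  proof (rule finite_subset)
    show "I \<subseteq> Pow (V \<times> {..<n})" using I_V I_n by (force simp: subset_iff)
  qed (use V in simp)
  have I_card: "finite Q" "Q \<noteq> {}" "card Q \<le> 4" if Q: "Q \<in> I" for Q
  proof -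
    obtain \<sigma> e f where "\<sigma> \<in> \<Omega>" and *: "e \<in> E" "f \<in> E" "Q = pattern \<sigma> (e \<union> f)"
      using I_D[OF Q] by blast
    then have ef: "card e = 2" "card f = 2" using E nsets_two_iff[of e V] nsets_two_iff[of f V] by blast+
    then have "finite e" "finite f" "e \<noteq> {}" by (auto intro: card_ge_0_finite)
    then show "finite Q" "Q \<noteq> {}" using * by (auto simp: pattern_def)
    show "card Q \<le> 4" using * ef card_Un_le[of e f] by simp
  qed
  let ?\<beta> = "2 * real n * real \<Delta> * (fact (n - 4) / fact n)"
  have \<beta>: "0 \<le> ?\<beta>" by simp
  note weight = sum_pattern_prob_UN_le[OF V E _ deg]
  \<comment> \<open>There are at most \<open>\<Delta>\<close> first edges through \<open>x\<close>,
    \<open>n choose 2\<close> possible images of the first edge, and at most \<open>k\<close> images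
    of the second for each of these.\<close>
  have dom: "(\<Sum>Q | Q \<in> I \<and> x \<in> fst ` Q. pattern_prob n Q) \<le> 1/32" if "x \<in> V" for x
  proof -
    have "(\<Sum>Q | Q \<in> I \<and> x \<in> fst ` Q. pattern_prob n Q)
        \<le> real (card {e \<in> E. x \<in> e}) * real (card M) * ?\<beta>"
    proof (rule weight)
      fix Q assume "Q \<in> {Q. Q \<in> I \<and> x \<in> fst ` Q}"
      then show "\<exists>e\<in>{e \<in> E. x \<in> e}. \<exists>(e', f')\<in>M. \<exists>f\<in>E - {e}. Q \<in> pair_patterns V n e f e' f'"
        using I_cases[of Q x] by blast
    qed (use n finM in auto)
    also have "\<dots> \<le> real \<Delta> * (real n * (real n - 1) / 2 * real k) * ?\<beta>"
    proof (intro mult_right_mono mult_mono \<beta>)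
      show "real (card {e \<in> E. x \<in> e}) \<le> real \<Delta>" using deg[OF that] by (simp add: degree_def)
      have "M = {m \<in> monochromatic_pairs \<chi> K. fst m \<in> K}"
        by (auto simp: M_def monochromatic_pairs_def)
      then have "card M \<le> (n choose 2) * k"
        using card_monochromatic_pairs_le[OF finK \<chi>, of K] by (simp add: K)
      then have "real (card M) \<le> real (n choose 2) * real k" by (metis of_nat_le_iff of_nat_mult)
      also have "real (n choose 2) = real n * (real n - 1) / 2"
        using n by (simp add: choose_two real_of_nat_div of_nat_diff)
      finally show "real (card M) \<le> real n * (real n - 1) / 2 * real k" .
    qed auto
    also have "\<dots> \<le> 1/32" using weight_numeric_bound[OF n k] .
    finally show ?thesis .
  qed
  \<comment> \<open>Dually, the first edge ranges over at most \<open>n * \<Delta> / 2\<close> edges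
    and its image over the at most \<open>n - 1\<close> edges through \<open>y\<close>. The product
    of the counts is bounded by the same quantity as for \<open>dom\<close>.\<close>
  have img: "(\<Sum>Q | Q \<in> I \<and> y \<in> snd ` Q. pattern_prob n Q) \<le> 1/32" if "y < n" for y
  proof -
    define L where "L = {e \<in> K. y \<in> e}"
    have "(\<Sum>Q | Q \<in> I \<and> y \<in> snd ` Q. pattern_prob n Q)
        \<le> real (card E) * real (card {m \<in> M. fst m \<in> L}) * ?\<beta>"
    proof (rule weight)
      fix Q assume "Q \<in> {Q. Q \<in> I \<and> y \<in> snd ` Q}"
      then have "Q \<in> I" "y \<in> snd ` Q" by auto
      \<comment> \<open>Taking the edge through the preimage \<open>z\<close> as the first puts
        \<open>y\<close> into the image of the first edge.\<close>
      then obtain z where z: "(z, y) \<in> Q" by auto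
      then have "z \<in> fst ` Q" by force
      then obtain \<sigma> e f where *: "\<sigma> \<in> \<Omega>" "e \<in> E" "f \<in> E - {e}" "(\<sigma> ` e, \<sigma> ` f) \<in> M"
        "Q = pattern \<sigma> (e \<union> f)" "Q \<in> pair_patterns V n e f (\<sigma> ` e) (\<sigma> ` f)" "z \<in> e"
        using I_cases[OF \<open>Q \<in> I\<close>] by blast
      then have "y \<in> \<sigma> ` e" using z by (auto simp: pattern_def)
      then have "(\<sigma> ` e, \<sigma> ` f) \<in> {m \<in> M. fst m \<in> L}"
        using * image_K by (simp add: L_def)
      then show "\<exists>e\<in>E. \<exists>(e', f')\<in>{m \<in> M. fst m \<in> L}. \<exists>f\<in>E - {e}. Q \<in> pair_patterns V n e f e' f'"
        using * by blast
    qed (use n finM in auto)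
    also have "\<dots> \<le> (real n * real \<Delta> / 2) * ((real n - 1) * real k) * ?\<beta>"
    proof (intro mult_right_mono mult_mono \<beta>)
      have "2 * card E \<le> n * \<Delta>"
        using sum_bounded_above[of V "degree E" \<Delta>] deg V degree_sum[OF V(1) E] by simp
      then have "real (2 * card E) \<le> real (n * \<Delta>)" by (simp only: of_nat_le_iff)
      then show "real (card E) \<le> real n * real \<Delta> / 2" by simp
      have "card {m \<in> M. fst m \<in> L} \<le> card L * k"
        unfolding M_def using finK \<chi> by (rule card_monochromatic_pairs_le) (auto simp: L_def)
      also have "\<dots> \<le> (n - 1) * k"
        using card_nsets_two_containing_le[of "{..<n}" y] that by (simp add: L_def K)
      finally have "real (card {m \<in> M. fst m \<in> L}) \<le> real (n - 1) * real k"
        by (metis of_nat_le_iff of_nat_mult)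
      then show "real (card {m \<in> M. fst m \<in> L}) \<le> (real n - 1) * real k"
        using n by (simp add: of_nat_diff)
    qed auto
    also have "\<dots> = real \<Delta> * (real n * (real n - 1) / 2 * real k) * ?\<beta>" by simp
    also have "\<dots> \<le> 1/32" using weight_numeric_bound[OF n k] .
    finally show ?thesis .
  qed

  have nn: "0 \<le> pattern_prob n Q" for Q :: "('a \<times> nat) set" by (simp add: pattern_prob_def)
  have "\<exists>\<sigma>\<in>\<Omega>. \<forall>Q\<in>I. \<not> realises \<sigma> Q"
  proof (rule lopsided_local_lemma[where p = "pattern_prob n" and nb = nb and A = "\<lambda>Q \<sigma>. realises \<sigma> Q"])
    show "finite \<Omega>" "finite I" "\<Omega> \<noteq> {}"
      using finI finite_bijections bijections_nonempty V by (auto simp: \<Omega>_def)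
    show "0 \<le> pattern_prob n Q" for Q :: "('a \<times> nat) set" by (rule nn)
    \<comment> \<open>A pattern is itself one of the summands in the bound for any point of its
      domain.\<close>
    show "pattern_prob n Q \<le> 1/4" if Q: "Q \<in> I" for Q
    proof -
      obtain x where x: "x \<in> fst ` Q" using I_card(2)[OF Q] by blast
      then have "x \<in> V" using I_V[OF Q] by blast
      have "pattern_prob n Q \<le> (\<Sum>Q | Q \<in> I \<and> x \<in> fst ` Q. pattern_prob n Q)"
        using x Q finI nn by (intro member_le_sum) auto
      then show ?thesis using dom[OF \<open>x \<in> V\<close>] by linarith
    qed
    show "(\<Sum>P | P \<in> I \<and> nb Q P. pattern_prob n P) \<le> 1/4" if Q: "Q \<in> I" for Q
    proof -
      \<comment> \<open>Each side of \<open>Q\<close> has at most four points of weight at most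
        1/32, so each side contributes at most 1/8.\<close>
      let ?X = "\<Union>x\<in>fst ` Q. {P. P \<in> I \<and> x \<in> fst ` P}"
      let ?Y = "\<Union>y\<in>snd ` Q. {P. P \<in> I \<and> y \<in> snd ` P}"
      have fin: "finite ?X" "finite ?Y" by (rule finite_subset[OF _ finI]; blast)+
      have c: "card (fst ` Q) \<le> 4" "card (snd ` Q) \<le> 4" "finite (fst ` Q)" "finite (snd ` Q)"
        using I_card[OF Q] card_image_le order_trans by blast+
      have "sum (pattern_prob n) ?X \<le> (\<Sum>x\<in>fst ` Q. \<Sum>P | P \<in> I \<and> x \<in> fst ` P. pattern_prob n P)"
        using c finI nn by (intro sum_UN_le) auto
      also have "\<dots> \<le> (\<Sum>x\<in>fst ` Q. 1/32)"
        using I_V[OF Q] by (intro sum_mono dom) auto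
      also have "\<dots> \<le> 1/8" using c(1) by simp
      finally have X: "sum (pattern_prob n) ?X \<le> 1/8" .
      have "sum (pattern_prob n) ?Y \<le> (\<Sum>y\<in>snd ` Q. \<Sum>P | P \<in> I \<and> y \<in> snd ` P. pattern_prob n P)"
        using c finI nn by (intro sum_UN_le) auto
      also have "\<dots> \<le> (\<Sum>y\<in>snd ` Q. 1/32)"
        using I_n[OF Q] by (intro sum_mono img) auto
      also have "\<dots> \<le> 1/8" using c(2) by simp
      finally have Y: "sum (pattern_prob n) ?Y \<le> 1/8" .
      have "{P. P \<in> I \<and> nb Q P} = ?X \<union> ?Y" unfolding nb_def by blast
      then have "(\<Sum>P | P \<in> I \<and> nb Q P. pattern_prob n P) = sum (pattern_prob n) (?X \<union> ?Y)" by simp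
      also have "\<dots> \<le> sum (pattern_prob n) ?X + sum (pattern_prob n) ?Y"
        using sum.union_inter[OF fin, of "pattern_prob n"] sum_nonneg[of "?X \<inter> ?Y" "pattern_prob n", OF nn]
        by linarith
      finally show ?thesis using X Y by linarith
    qed
    show "real (card {\<sigma> \<in> \<Omega>. realises \<sigma> Q \<and> (\<forall>P\<in>T. \<not> realises \<sigma> P)})
        \<le> pattern_prob n Q * real (card {\<sigma> \<in> \<Omega>. \<forall>P\<in>T. \<not> realises \<sigma> P})"
      if Q: "Q \<in> I" and T: "T \<subseteq> I" "\<And>P. P \<in> T \<Longrightarrow> \<not> nb Q P" for Q T
    proof -
      obtain \<rho> e f where *: "\<rho> \<in> \<Omega>" "e \<in> E" "f \<in> E" "Q = pattern \<rho> (e \<union> f)"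
        using I_D[OF Q] by blast
      have sub: "e \<union> f \<subseteq> V" using I_V[OF Q] * by simp
      have "fst ` P \<inter> (e \<union> f) = {} \<and> snd ` P \<inter> \<rho> ` (e \<union> f) = {} \<and> fst ` P \<subseteq> V" if "P \<in> T" for P
        using T(2)[OF that] I_V[of P] T(1) that unfolding nb_def *(4) fst_pattern snd_pattern by blast
      from bijections_lopsided[OF V sub *(1)[unfolded \<Omega>_def] this] show ?thesis
        by (simp add: \<Omega>_def pattern_prob_def *(4))
    qed
  qed
  then obtain \<sigma> where \<sigma>: "\<sigma> \<in> \<Omega>" and avoid: "\<And>Q. Q \<in> I \<Longrightarrow> \<not> realises \<sigma> Q" by blast
  have "is_copy_in_complete V E n (\<sigma> ` V) {\<sigma> ` e | e. e \<in> E}"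
    unfolding is_copy_in_complete_def
    by (rule exI[of _ \<sigma>]) (use \<sigma> in \<open>auto simp: \<Omega>_def bijections_def bij_betw_def complete_verts_def\<close>)
  moreover have "rainbow_edges \<chi> {\<sigma> ` e | e. e \<in> E}"
    unfolding rainbow_edges_def
  proof (intro ballI impI notI)
    fix e' f' assume "e' \<in> {\<sigma> ` e | e. e \<in> E}" "f' \<in> {\<sigma> ` e | e. e \<in> E}" "e' \<noteq> f'" "\<chi> e' = \<chi> f'"
    then obtain e f where "e \<in> E" "f \<in> E" "e \<noteq> f" "\<chi> (\<sigma> ` e) = \<chi> (\<sigma> ` f)" by blast
    \<comment> \<open>A repeated colour would make the pattern of \<open>\<sigma>\<close> itself on
      \<open>e \<union> f\<close> a bad one, and \<open>\<sigma>\<close> realises it.\<close>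
    then have "pattern \<sigma> (e \<union> f) \<in> I" using \<sigma> unfolding I_def by blast
    then have "\<not> realises \<sigma> (pattern \<sigma> (e \<union> f))" by (rule avoid)
    then show False by (simp add: realises_pattern)
  qed
  ultimately show ?thesis unfolding graph_rainbow_def by blast
qed

end
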